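(* The shrink property is algorithmically decidable on $\mathcal{G}$: there is an algorithm which, given a graph $G=(\mathbb{Z},E)\in\mathcal{G}$ described by a translation period $L$, its interaction range $K$ and its edges (up to translation by $L$), terminates after a number of operations bounded in terms of $L$ and $K$ and correctly determines whether or not $G$ has the shrink property.
   Context: $\mathcal{G}$ is the collection of connected graphs $G=(\mathbb{Z},E)$ such that: (A1) there exists an integer $L\ge 1$ (a translation period) with $\{x,y\}\in E \iff \{x+L,y+L\}\in E$ for all $x,y\in\mathbb{Z}$; (A2) the maximal degree of $G$ is finite. The interaction range is $K=\max\{|x-y|:\{x,y\}\in E\}<\infty$; thus $G$ is determined by $L$ and the finite set of edges meeting $\{1,\dots,L\}$. For a graph $G=(V,E)$, $S\subset V$ and $u\in V$, write $\deg_S(u)=|\{v\in S:\{u,v\}\in E\}|$. $G$ has the shrink property if for each nonempty finite $S\subset V$ there exists $u\in S$ with $\deg_{V\setminus S}(u)\ge \deg_S(u)$. *)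

theory Defs
  imports Main "HOL-Library.Nat_Bijection"
begin

definition simple_graph :: "'a set \<Rightarrow> 'a set set \<Rightarrow> bool" where
  "simple_graph V E \<longleftrightarrow> (\<forall>e\<in>E. e \<subseteq> V \<and> card e = 2)"

definition connected_graph :: "'a set \<Rightarrow> 'a set set \<Rightarrow> bool" where
  "connected_graph V E \<longleftrightarrow> (\<forall>x\<in>V. \<forall>y\<in>V. (x, y) \<in> {(u, v). {u, v} \<in> E}\<^sup>*)"

text \<open>Since \<open>card\<close> is \<open>0\<close> on infinite sets, \<open>deg_in\<close> is the true degree only
  for vertices of finite degree; all graphs below have bounded degree.\<close>

definition deg_in :: "'a set set \<Rightarrow> 'a set \<Rightarrow> 'a \<Rightarrow> nat" where
  "deg_in E S u = card {v \<in> S. {u, v} \<in> E}"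

definition bounded_degree :: "'a set \<Rightarrow> 'a set set \<Rightarrow> bool" where
  "bounded_degree V E \<longleftrightarrow>
     (\<exists>D. \<forall>u\<in>V. finite {v \<in> V. {u, v} \<in> E} \<and> deg_in E V u \<le> D)"

definition shrink_property :: "'a set \<Rightarrow> 'a set set \<Rightarrow> bool" where
  "shrink_property V E \<longleftrightarrow>
     (\<forall>S. S \<subseteq> V \<and> S \<noteq> {} \<and> finite S \<longrightarrow> (\<exists>u\<in>S. deg_in E (V - S) u \<ge> deg_in E S u))"

definition translation_period :: "int set set \<Rightarrow> nat \<Rightarrow> bool" where
  "translation_period E L \<longleftrightarrow>
     L \<ge> 1 \<and> (\<forall>x y. {x, y} \<in> E \<longleftrightarrow> {x + int L, y + int L} \<in> E)"

definition periodic_graphs :: "int set set set" where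
  "periodic_graphs =
     {E. simple_graph UNIV E \<and> connected_graph UNIV E \<and>
         (\<exists>L. translation_period E L) \<and> bounded_degree UNIV E}"

definition interaction_range :: "int set set \<Rightarrow> nat" where
  "interaction_range E = Max {nat \<bar>x - y\<bar> | x y. {x, y} \<in> E}"

definition base_edges :: "int set set \<Rightarrow> nat \<Rightarrow> int set set" where
  "base_edges E L = {e \<in> E. e \<inter> {1..int L} \<noteq> {}}"

text \<open>Algorithms are while programs over registers holding natural numbers.  This model of
  computation is Turing complete; each assignment and each loop test is one operation, and no
  operation changes a register to more than one above the value of some register.\<close>

datatype rhs = Zero | Reg nat | Succ nat | Pred nat

datatype prog =
    Assign nat rhs
  | Seq prog prog
  | While nat prog

type_synonym state = "nat \<Rightarrow> nat"

fun rhs_val :: "rhs \<Rightarrow> state \<Rightarrow> nat" where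
  "rhs_val Zero s = 0"
| "rhs_val (Reg i) s = s i"
| "rhs_val (Succ i) s = s i + 1"
| "rhs_val (Pred i) s = s i - 1"

text \<open>\<open>exec p s n s'\<close>: started in state \<open>s\<close>, the program \<open>p\<close> halts in state \<open>s'\<close> after
  exactly \<open>n\<close> operations.  \<open>While i p\<close> repeats \<open>p\<close> as long as register \<open>i\<close> is nonzero.\<close>

inductive exec :: "prog \<Rightarrow> state \<Rightarrow> nat \<Rightarrow> state \<Rightarrow> bool" where
  Assign: "exec (Assign i r) s 1 (s(i := rhs_val r s))"
| Seq: "exec p s m s' \<Longrightarrow> exec q s' n s'' \<Longrightarrow> exec (Seq p q) s (m + n) s''"
| While_stop: "s i = 0 \<Longrightarrow> exec (While i p) s 1 s"
| While_step: "s i \<noteq> 0 \<Longrightarrow> exec p s m s' \<Longrightarrow> exec (While i p) s' n s'' \<Longrightarrow>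
    exec (While i p) s (1 + m + n) s''"

inductive_cases exec_AssignE: "exec (Assign i r) s n s'"
inductive_cases exec_SeqE: "exec (Seq p q) s n s'"
inductive_cases exec_WhileE: "exec (While i p) s n s'"

lemma exec_deterministic:
  "exec p s m s' \<Longrightarrow> exec p s n s'' \<Longrightarrow> n = m \<and> s'' = s'"
proof (induction arbitrary: n s'' rule: exec.induct)
  case (Assign i r s)
  from Assign.prems show ?case by (rule exec_AssignE) simp
next
  case (Seq p s m s' q k t)
  from Seq.prems obtain m1 k1 s1 where
    "exec p s m1 s1" "exec q s1 k1 s''" "n = m1 + k1"
    by (rule exec_SeqE)
  with Seq.IH(1)[OF this(1)] Seq.IH(2)[of k1 s''] show ?case by simp
next
  case (While_stop s i p)
  from While_stop.prems show ?case
    by (rule exec_WhileE) (use While_stop.hyps in simp_all)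
next
  case (While_step s i p m s' k t)
  from While_step.prems obtain m1 k1 s1 where
    "exec p s m1 s1" "exec (While i p) s1 k1 s''" "n = 1 + m1 + k1"
    by (rule exec_WhileE) (use While_step.hyps in simp_all)
  with While_step.IH(1)[OF this(1)] While_step.IH(2)[of k1 s''] show ?case by simp
qed

definition input_state :: "nat list \<Rightarrow> state" where
  "input_state xs = (\<lambda>i. if i < length xs then xs ! i else 0)"

text \<open>A finite set of edges, as a natural number: integers are coded by \<open>int_encode\<close>, and
  \<open>set_encode A\<close> is the number whose binary digits are \<open>1\<close> exactly at the positions in \<open>A\<close>.\<close>

definition edges_encode :: "int set set \<Rightarrow> nat" where
  "edges_encode F = set_encode ((\<lambda>e. set_encode (int_encode ` e)) ` F)"

text \<open>The input registers hold the period, the interaction range and the code of the edges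
  meeting \<open>{1..L}\<close>.\<close>

definition graph_input :: "int set set \<Rightarrow> nat \<Rightarrow> state" where
  "graph_input E L = input_state [L, interaction_range E, edges_encode (base_edges E L)]"

end

theory Submission
  imports Defs
begin

text \<open>The shrink property fails exactly when some nonempty finite \<open>S\<close> is a majority set: each of its
  vertices has more neighbours inside \<open>S\<close> than outside. Whether a vertex satisfies this depends only
  on its residue modulo \<open>L\<close> and on the part of \<open>S\<close> within distance \<open>K\<close>. Hence, if \<open>S\<close> looks the same in
  two windows of length \<open>2 * K\<close> whose distance is a multiple of \<open>L\<close>, the stretch between them can be
  removed and the right part of \<open>S\<close> moved up to fill the gap (\<open>majority_set_cut\<close>): every vertex of the
  new set sees what some vertex of \<open>S\<close> saw. A window has only \<open>4 ^ K\<close> possible contents, so repeated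
  cutting brings a majority set, translated to start just above \<open>K\<close>, below a bound computable from
  \<open>L\<close> and \<open>K\<close> (\<open>majority_set_confine\<close>). The shrink property is thereby decided by inspecting finitely
  many sets.

  It remains to carry out this search by a while program. With finite sets of
  natural numbers coded by their binary digits, the search becomes a formula built from arithmetic and bounded
  quantifiers (\<open>has_majority_code\<close>). Such formulas are decidable because the functions computed by
  while programs are closed under primitive recursion (\<open>computable_rec\<close>). The running time
  is bounded in terms of \<open>L\<close> and \<open>K\<close> by a finiteness argument: the program halts on all inputs, and
  for given \<open>L\<close> and \<open>K\<close> only finitely many inputs come from a graph.\<close>

section \<open>Functions computed by while programs\<close>

text \<open>The list \<open>X\<close> plays the role of a context of variables: each variable is a function of an
  abstract environment \<open>x\<close>, and \<open>ls\<close> gives the registers that hold their values. The result goes to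
  register \<open>m\<close>, everything below \<open>m\<close> is preserved, and everything above \<open>m\<close> is scratch space with
  arbitrary initial contents.\<close>

definition evaluates :: "('a \<Rightarrow> nat) list \<Rightarrow> ('a \<Rightarrow> nat) \<Rightarrow> nat list \<Rightarrow> nat \<Rightarrow> prog \<Rightarrow> bool" where
  "evaluates X f ls m p \<longleftrightarrow>
     (\<forall>x s. map s ls = map (\<lambda>v. v x) X \<longrightarrow>
       (\<exists>n s'. exec p s n s' \<and> s' m = f x \<and> (\<forall>i<m. s' i = s i)))"

text \<open>Quantifying over all placements \<open>ls\<close> and \<open>m\<close> makes programs relocatable, so that the
  code for a subexpression can be inserted at any stack height.\<close>

definition computable :: "('a \<Rightarrow> nat) list \<Rightarrow> ('a \<Rightarrow> nat) \<Rightarrow> bool" where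
  "computable X f \<longleftrightarrow> (\<forall>ls m. (\<forall>l\<in>set ls. l < m) \<longrightarrow> (\<exists>p. evaluates X f ls m p))"

abbreviation decidable :: "('a \<Rightarrow> nat) list \<Rightarrow> ('a \<Rightarrow> bool) \<Rightarrow> bool" where
  "decidable X P \<equiv> computable X (\<lambda>x. of_bool (P x))"

text \<open>Entering the scope of a binder adds a component to the environment; the bound variable is the
  last entry of the context.\<close>

definition push :: "('a \<Rightarrow> nat) list \<Rightarrow> ('a \<times> nat \<Rightarrow> nat) list" where
  "push X = map (\<lambda>v z. v (fst z)) X @ [snd]"

lemma evaluatesI:
  assumes "\<And>x s. map s ls = map (\<lambda>v. v x) X \<Longrightarrow>
    \<exists>n s'. exec p s n s' \<and> s' m = f x \<and> (\<forall>i<m. s' i = s i)"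
  shows "evaluates X f ls m p"
  using assms by (simp add: evaluates_def)

lemma evaluatesE:
  assumes "evaluates X f ls m p" and "map s ls = map (\<lambda>v. v x) X"
  obtains n s' where "exec p s n s'" and "s' m = f x" and "\<forall>i<m. s' i = s i"
  using assms unfolding evaluates_def by blast

lemma computableI:
  assumes "\<And>ls m. \<forall>l\<in>set ls. l < m \<Longrightarrow> \<exists>p. evaluates X f ls m p"
  shows "computable X f"
  using assms by (simp add: computable_def)

lemma computableE:
  assumes "computable X f" and "\<forall>l\<in>set ls. l < m"
  obtains p where "evaluates X f ls m p"
  using assms unfolding computable_def by blast

lemma map_preserved:
  assumes "\<forall>l\<in>set ls. l < m" and "\<And>i. i < m \<Longrightarrow> s' i = s i"
  shows "map s' ls = map s ls"
  using assms by simp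

lemma computable_var:
  assumes "v \<in> set X"
  shows "computable X v"
proof (rule computableI)
  fix ls :: "nat list" and m
  obtain k where k: "k < length X" "X ! k = v"
    using assms by (auto simp: in_set_conv_nth)
  have "evaluates X v ls m (Assign m (Reg (ls ! k)))"
  proof (rule evaluatesI)
    fix x s
    assume eq: "map s ls = map (\<lambda>v. v x) X"
    have "length ls = length X" using eq by (metis length_map)
    with eq k have "s (ls ! k) = v x" by (metis nth_map)
    with exec.Assign[of m "Reg (ls ! k)" s]
    show "\<exists>n s'. exec (Assign m (Reg (ls ! k))) s n s' \<and> s' m = v x \<and> (\<forall>i<m. s' i = s i)"
      by fastforce
  qed
  then show "\<exists>p. evaluates X v ls m p" ..
qed

lemma computable_zero: "computable X (\<lambda>x. 0)"
proof (rule computableI)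
  fix ls :: "nat list" and m
  have "evaluates X (\<lambda>x. 0) ls m (Assign m Zero)"
    using exec.Assign[of m Zero] by (intro evaluatesI) fastforce
  then show "\<exists>p. evaluates X (\<lambda>x. 0) ls m p" ..
qed

lemma computable_Suc:
  assumes "computable X f"
  shows "computable X (\<lambda>x. Suc (f x))"
proof (rule computableI)
  fix ls :: "nat list" and m
  assume ls: "\<forall>l\<in>set ls. l < m"
  obtain p where p: "evaluates X f ls m p"
    using computableE[OF assms ls] .
  have "evaluates X (\<lambda>x. Suc (f x)) ls m (Seq p (Assign m (Succ m)))"
  proof (rule evaluatesI)
    fix x s
    assume "map s ls = map (\<lambda>v. v x) X"
    with p obtain n s' where s': "exec p s n s'" "s' m = f x" "\<forall>i<m. s' i = s i"
      by (rule evaluatesE)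
    show "\<exists>n s'. exec (Seq p (Assign m (Succ m))) s n s' \<and> s' m = Suc (f x) \<and>
        (\<forall>i<m. s' i = s i)"
      using exec.Seq[OF s'(1) exec.Assign[of m "Succ m"]] s'(2,3) by fastforce
  qed
  then show "\<exists>p. evaluates X (\<lambda>x. Suc (f x)) ls m p" ..
qed

text \<open>A program for the outer scope also works in the inner one: the register of the bound
  variable, the last entry of \<open>ls\<close>, is merely a register to be preserved.\<close>

lemma computable_push:
  assumes "computable X f"
  shows "computable (push X) (\<lambda>z. f (fst z))"
proof (rule computableI)
  fix ls :: "nat list" and m
  assume "\<forall>l\<in>set ls. l < m"
  then have "\<forall>l\<in>set (butlast ls). l < m" by (meson in_set_butlastD)
  with assms obtain p where p: "evaluates X f (butlast ls) m p"
    by (rule computableE)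
  have "evaluates (push X) (\<lambda>z. f (fst z)) ls m p"
  proof (rule evaluatesI)
    fix z :: "'a \<times> nat" and s
    assume "map s ls = map (\<lambda>v. v z) (push X)"
    from arg_cong[OF this, of butlast]
    have "map s (butlast ls) = map (\<lambda>v. v (fst z)) X"
      by (simp add: push_def map_butlast o_def)
    with p obtain n s' where "exec p s n s'" "s' m = f (fst z)" "\<forall>i<m. s' i = s i"
      by (rule evaluatesE)
    then show "\<exists>n s'. exec p s n s' \<and> s' m = f (fst z) \<and> (\<forall>i<m. s' i = s i)" by blast
  qed
  then show "\<exists>p. evaluates (push X) (\<lambda>z. f (fst z)) ls m p" ..
qed

text \<open>Primitive recursion is a counting loop: the accumulator, the index and the number of remaining
  rounds sit in three consecutive registers, and the code for the step sees the first two as its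
  bound variables.\<close>

lemma computable_rec:
  assumes "computable X a" and "computable X h"
    and "computable (push (push X)) (\<lambda>z. g (fst (fst z)) (snd (fst z)) (snd z))"
  shows "computable X (\<lambda>x. rec_nat (a x) (g x) (h x))"
proof (rule computableI)
  fix ls :: "nat list" and m
  assume ls: "\<forall>l\<in>set ls. l < m"
  then have ls2: "\<forall>l\<in>set ls. l < m + 2"
    and ls3: "\<forall>l\<in>set (ls @ [m + 1, m]). l < m + 3"
    by auto
  obtain pa where pa: "evaluates X a ls m pa"
    using computableE[OF assms(1) ls] .
  obtain ph where ph: "evaluates X h ls (m + 2) ph"
    using computableE[OF assms(2) ls2] .
  obtain pg where pg: "evaluates (push (push X)) (\<lambda>z. g (fst (fst z)) (snd (fst z)) (snd z))
      (ls @ [m + 1, m]) (m + 3) pg"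
    using computableE[OF assms(3) ls3] .
  define body where "body =
    Seq pg (Seq (Assign m (Reg (m + 3)))
      (Seq (Assign (m + 1) (Succ (m + 1))) (Assign (m + 2) (Pred (m + 2)))))"
  have loop: "\<exists>n s'. exec (While (m + 2) body) s n s' \<and>
      s' m = rec_nat (a x) (g x) (i + k) \<and> (\<forall>i<m. s' i = s i)"
    if "map s ls = map (\<lambda>v. v x) X" "s m = rec_nat (a x) (g x) i" "s (m + 1) = i" "s (m + 2) = k"
    for x s i k
    using that
  proof (induction k arbitrary: s i)
    case 0
    then show ?case using exec.While_stop[of s "m + 2" body] by auto
  next
    case (Suc k)
    have "map s (ls @ [m + 1, m]) =
        map (\<lambda>v. v ((x, i), rec_nat (a x) (g x) i)) (push (push X))"
      using Suc.prems by (simp add: push_def)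
    with pg obtain n1 s1 where s1: "exec pg s n1 s1"
      "s1 (m + 3) = g x i (rec_nat (a x) (g x) i)" "\<forall>i<m + 3. s1 i = s i"
      by (rule evaluatesE) simp
    define s2 where "s2 = s1(m := s1 (m + 3))"
    define s3 where "s3 = s2(m + 1 := Suc i)"
    define s4 where "s4 = s3(m + 2 := k)"
    have e2: "exec (Assign m (Reg (m + 3))) s1 1 s2"
      using exec.Assign[of m "Reg (m + 3)" s1] by (simp add: s2_def)
    have "s2 (m + 1) = i"
      using s1(3) Suc.prems by (simp add: s2_def)
    then have e3: "exec (Assign (m + 1) (Succ (m + 1))) s2 1 s3"
      using exec.Assign[of "m + 1" "Succ (m + 1)" s2] by (simp add: s3_def)
    have "s3 (m + 2) = Suc k"
      using s1(3) Suc.prems by (simp add: s2_def s3_def)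
    then have e4: "exec (Assign (m + 2) (Pred (m + 2))) s3 1 s4"
      using exec.Assign[of "m + 2" "Pred (m + 2)" s3] by (simp add: s4_def)
    have b: "exec body s (n1 + (1 + (1 + 1))) s4"
      unfolding body_def by (rule exec.Seq[OF s1(1) exec.Seq[OF e2 exec.Seq[OF e3 e4]]])
    have low: "s4 j = s j" if "j < m" for j
      using s1(3) that by (simp add: s2_def s3_def s4_def)
    have "map s4 ls = map (\<lambda>v. v x) X"
      using Suc.prems(1) map_preserved[where s' = s4, OF ls low] by simp
    moreover have "s4 m = rec_nat (a x) (g x) (Suc i)" "s4 (m + 1) = Suc i" "s4 (m + 2) = k"
      using s1(2) by (simp_all add: s2_def s3_def s4_def)
    ultimately obtain n5 s5 where s5: "exec (While (m + 2) body) s4 n5 s5"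
      "s5 m = rec_nat (a x) (g x) (Suc i + k)" "\<forall>i<m. s5 i = s4 i"
      using Suc.IH by blast
    have "exec (While (m + 2) body) s (1 + (n1 + (1 + (1 + 1))) + n5) s5"
      by (rule exec.While_step[OF _ b s5(1)]) (use Suc.prems in simp)
    with s5 low show ?case by (metis add_Suc add_Suc_right)
  qed
  define p where "p = Seq pa (Seq (Assign (m + 1) Zero) (Seq ph (While (m + 2) body)))"
  have "evaluates X (\<lambda>x. rec_nat (a x) (g x) (h x)) ls m p"
  proof (rule evaluatesI)
    fix x s
    assume eq: "map s ls = map (\<lambda>v. v x) X"
    with pa obtain n1 s1 where s1: "exec pa s n1 s1" "s1 m = a x" "\<forall>i<m. s1 i = s i"
      by (rule evaluatesE)
    define s2 where "s2 = s1(m + 1 := 0)"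
    have e2: "exec (Assign (m + 1) Zero) s1 1 s2"
      using exec.Assign[of "m + 1" Zero s1] by (simp add: s2_def)
    have "map s2 ls = map s ls"
      by (rule map_preserved[OF ls]) (use s1(3) in \<open>simp add: s2_def\<close>)
    also note eq
    finally have "map s2 ls = map (\<lambda>v. v x) X" .
    with ph obtain n3 s3 where s3: "exec ph s2 n3 s3" "s3 (m + 2) = h x"
      "\<forall>i<m + 2. s3 i = s2 i"
      by (rule evaluatesE)
    have low: "s3 i = s i" if "i < m" for i
      using that s3(3) s1(3) by (simp add: s2_def)
    have "map s3 ls = map (\<lambda>v. v x) X"
      using map_preserved[where s' = s3, OF ls low] eq by simp
    moreover have "s3 m = rec_nat (a x) (g x) 0" "s3 (m + 1) = 0"
      using s3(3) s1(2) by (simp_all add: s2_def)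
    ultimately obtain n4 s4 where s4: "exec (While (m + 2) body) s3 n4 s4"
      "s4 m = rec_nat (a x) (g x) (0 + h x)" "\<forall>i<m. s4 i = s3 i"
      using loop s3(2) by blast
    have "exec p s (n1 + (1 + (n3 + n4))) s4"
      unfolding p_def by (rule exec.Seq[OF s1(1) exec.Seq[OF e2 exec.Seq[OF s3(1) s4(1)]]])
    with s4 low show "\<exists>n s'. exec p s n s' \<and> s' m = rec_nat (a x) (g x) (h x) \<and>
        (\<forall>i<m. s' i = s i)"
      by auto
  qed
  then show "\<exists>p. evaluates X (\<lambda>x. rec_nat (a x) (g x) (h x)) ls m p" ..
qed

section \<open>Arithmetic and bounded quantifiers\<close>

lemma computable_snd: "computable (push X) snd"
  by (rule computable_var) (simp add: push_def)

lemma computable_const: "computable X (\<lambda>x. c)"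
  by (induction c) (simp_all add: computable_zero computable_Suc)

lemma computable_add:
  assumes "computable X f" and "computable X g"
  shows "computable X (\<lambda>x. f x + g x)"
proof -
  have eq: "m + n = rec_nat m (\<lambda>i r. Suc r) n" for m n :: nat
    by (induction n) simp_all
  show ?thesis
    unfolding eq by (intro computable_rec computable_Suc computable_snd assms)
qed

lemma computable_diff:
  assumes "computable X f" and "computable X g"
  shows "computable X (\<lambda>x. f x - g x)"
proof -
  have pred: "n - 1 = rec_nat 0 (\<lambda>i r. i) n" for n :: nat
    by (cases n) simp_all
  have eq: "m - n = rec_nat m (\<lambda>i r. rec_nat 0 (\<lambda>i r. i) r) n" for m n :: nat
    unfolding pred[symmetric] by (induction n) simp_all
  show ?thesis
    unfolding eq
    by (intro computable_rec computable_zero computable_push computable_snd assms)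
qed

lemma computable_mult:
  assumes "computable X f" and "computable X g"
  shows "computable X (\<lambda>x. f x * g x)"
proof -
  have eq: "m * n = rec_nat 0 (\<lambda>i r. r + m) n" for m n :: nat
    by (induction n) simp_all
  show ?thesis
    unfolding eq
    by (intro computable_rec computable_zero computable_add computable_snd
        computable_push[OF computable_push] assms)
qed

lemma computable_power:
  assumes "computable X f" and "computable X g"
  shows "computable X (\<lambda>x. f x ^ g x)"
proof -
  have eq: "m ^ n = rec_nat 1 (\<lambda>i r. r * m) n" for m n :: nat
    by (induction n) simp_all
  show ?thesis
    unfolding eq
    by (intro computable_rec computable_const computable_mult computable_snd
        computable_push[OF computable_push] assms)
qed

lemma computable_card:
  assumes "computable X h" and "decidable (push X) (\<lambda>z. P (fst z) (snd z))"
  shows "computable X (\<lambda>x. card {i. i < h x \<and> P x i})"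
proof -
  have eq: "card {i. i < n \<and> Q i} = rec_nat 0 (\<lambda>i r. r + of_bool (Q i)) n" for n Q
  proof (induction n)
    case (Suc n)
    have "{i. i < Suc n \<and> Q i} = (if Q n then insert n {i. i < n \<and> Q i} else {i. i < n \<and> Q i})"
      by (auto simp: less_Suc_eq)
    with Suc show ?case by simp
  qed simp
  show ?thesis
    unfolding eq
    by (intro computable_rec computable_zero computable_add computable_snd
        computable_push[OF assms(2)] assms(1))
qed

lemma decidable_not:
  assumes "decidable X P"
  shows "decidable X (\<lambda>x. \<not> P x)"
proof -
  have eq: "of_bool (\<not> b) = 1 - (of_bool b :: nat)" for b by simp
  show ?thesis unfolding eq by (intro computable_diff computable_const assms)
qed

lemma decidable_conj:
  assumes "decidable X P" and "decidable X Q"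
  shows "decidable X (\<lambda>x. P x \<and> Q x)"
  unfolding of_bool_conj by (intro computable_mult assms)

lemma decidable_imp:
  assumes "decidable X P" and "decidable X Q"
  shows "decidable X (\<lambda>x. P x \<longrightarrow> Q x)"
  using decidable_not[OF decidable_conj[OF assms(1) decidable_not[OF assms(2)]]] by simp

lemma decidable_less:
  assumes "computable X f" and "computable X g"
  shows "decidable X (\<lambda>x. f x < g x)"
proof -
  have eq: "of_bool (m < n) = 1 - (1 - (n - m))" for m n :: nat by simp
  show ?thesis unfolding eq by (intro computable_diff computable_const assms)
qed

lemma decidable_eq:
  assumes "computable X f" and "computable X g"
  shows "decidable X (\<lambda>x. f x = g x)"
proof -
  have eq: "m = n \<longleftrightarrow> \<not> m < n \<and> \<not> n < m" for m n :: nat by auto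
  show ?thesis unfolding eq by (intro decidable_conj decidable_not decidable_less assms)
qed

lemma decidable_ex:
  assumes "computable X h" and "decidable (push X) (\<lambda>z. P (fst z) (snd z))"
  shows "decidable X (\<lambda>x. \<exists>i<h x. P x i)"
proof -
  have eq: "(\<exists>i<n. Q i) \<longleftrightarrow> 0 < card {i. i < n \<and> Q i}" for n :: nat and Q
    by (auto simp: card_gt_0_iff)
  show ?thesis
    unfolding eq by (intro decidable_less computable_const computable_card assms)
qed

lemma decidable_all:
  assumes "computable X h" and "decidable (push X) (\<lambda>z. P (fst z) (snd z))"
  shows "decidable X (\<lambda>x. \<forall>i<h x. P x i)"
  using decidable_not[OF decidable_ex[where P = "\<lambda>x i. \<not> P x i", OF assms(1)
      decidable_not[OF assms(2)]]] by simp

text \<open>This form of the definition of a binary digit replaces division by bounded search.\<close>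

lemma mem_set_decode_iff:
  "q \<in> set_decode c \<longleftrightarrow> (\<exists>a<c + 1. \<exists>b<2 ^ q. c = (2 * a + 1) * 2 ^ q + b)"
proof
  assume "q \<in> set_decode c"
  then obtain a where a: "c div 2 ^ q = 2 * a + 1"
    by (auto simp: set_decode_def elim: oddE)
  have c: "c = (2 * a + 1) * 2 ^ q + c mod 2 ^ q"
    using div_mult_mod_eq[of c "2 ^ q"] a by simp
  have "a \<le> c div 2 ^ q" using a by simp
  also have "\<dots> \<le> c" by simp
  finally have "a < c + 1" by simp
  moreover have "c mod 2 ^ q < 2 ^ q" by simp
  ultimately show "\<exists>a<c + 1. \<exists>b<2 ^ q. c = (2 * a + 1) * 2 ^ q + b"
    using c by blast
next
  assume "\<exists>a<c + 1. \<exists>b<2 ^ q. c = (2 * a + 1) * 2 ^ q + b"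
  then obtain a b where "b < 2 ^ q" "c = (2 * a + 1) * 2 ^ q + b" by blast
  then have "c div 2 ^ q = 2 * a + 1"
    using div_mult_self1[of "2 ^ q" b "2 * a + 1"] by (simp add: add.commute)
  then show "q \<in> set_decode c" by (simp add: set_decode_def)
qed

lemma decidable_mem_set_decode:
  assumes "computable X f" and "computable X g"
  shows "decidable X (\<lambda>x. f x \<in> set_decode (g x))"
  unfolding mem_set_decode_iff
  by (intro decidable_ex decidable_eq computable_add computable_mult computable_power
      computable_const computable_push computable_snd assms)

lemmas computable_intros =
  decidable_not decidable_conj decidable_imp decidable_less decidable_eq decidable_ex decidable_all
  decidable_mem_set_decode computable_card computable_add computable_diff computable_mult
  computable_power computable_const computable_snd computable_push

section \<open>Cutting a majority set\<close>

definition majority_set :: "'a set set \<Rightarrow> 'a set \<Rightarrow> bool" where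
  "majority_set E S \<longleftrightarrow>
     finite S \<and> S \<noteq> {} \<and> (\<forall>u\<in>S. deg_in E (- S) u < deg_in E S u)"

lemma shrink_property_iff: "shrink_property UNIV E \<longleftrightarrow> (\<nexists>S. majority_set E S)"
  unfolding shrink_property_def majority_set_def Compl_eq_Diff_UNIV not_le[symmetric] by blast

lemma period_shift:
  assumes "translation_period E L"
  shows "{x + t * int L, y + t * int L} \<in> E \<longleftrightarrow> {x, y} \<in> E"
proof -
  have pos: "{x + int n * int L, y + int n * int L} \<in> E \<longleftrightarrow> {x, y} \<in> E" for n x y
  proof (induction n)
    case (Suc n)
    have "{x + int n * int L, y + int n * int L} \<in> E \<longleftrightarrow>
        {x + int n * int L + int L, y + int n * int L + int L} \<in> E"
      using assms unfolding translation_period_def by blast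
    with Suc show ?case by (simp add: algebra_simps)
  qed simp
  show ?thesis
  proof (cases t)
    case (nonneg n)
    with pos show ?thesis by simp
  next
    case (neg n)
    have "z + t * int L + int (Suc n) * int L = z" for z
      unfolding neg by (simp add: algebra_simps)
    with pos[of "x + t * int L" "Suc n" "y + t * int L"] show ?thesis
      by (simp only:)
  qed
qed

definition edges_within :: "int set set \<Rightarrow> nat \<Rightarrow> bool" where
  "edges_within E K \<longleftrightarrow> (\<forall>x y. {x, y} \<in> E \<longrightarrow> \<bar>x - y\<bar> \<le> int K)"

lemma edges_withinD:
  assumes "edges_within E K" and "{x, y} \<in> E"
  shows "\<bar>x - y\<bar> \<le> int K"
  using assms by (simp add: edges_within_def)

text \<open>The maximum that defines the interaction range is over a finite set: by periodicity all
  distances already occur at edges with an end in \<open>{0..<L}\<close>, and degrees are finite.\<close>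

lemma edges_within_interaction_range:
  assumes "bounded_degree UNIV E" and per: "translation_period E L"
  shows "edges_within E (interaction_range E)"
  unfolding edges_within_def
proof (intro allI impI)
  fix x y assume "{x, y} \<in> E"
  have L: "0 < int L" using per by (simp add: translation_period_def)
  have fin: "finite {y. {x, y} \<in> E}" for x
    using assms(1) by (auto simp: bounded_degree_def)
  let ?D = "{nat \<bar>x - y\<bar> | x y. {x, y} \<in> E}"
  have "?D \<subseteq> (\<lambda>(x, y). nat \<bar>x - y\<bar>) ` (SIGMA x:{0..<int L}. {y. {x, y} \<in> E})"
  proof
    fix d assume "d \<in> ?D"
    then obtain x y where d: "d = nat \<bar>x - y\<bar>" and e: "{x, y} \<in> E" by blast
    let ?t = "- (x div int L)"
    have "{x + ?t * int L, y + ?t * int L} \<in> E"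
      using e period_shift[OF per] by blast
    moreover have "x + ?t * int L = x mod int L"
      by (simp add: minus_div_mult_eq_mod)
    then have "x + ?t * int L \<in> {0..<int L}" using L by simp
    ultimately have "(x + ?t * int L, y + ?t * int L) \<in> (SIGMA x:{0..<int L}. {y. {x, y} \<in> E})"
      by blast
    then show "d \<in> (\<lambda>(x, y). nat \<bar>x - y\<bar>) ` (SIGMA x:{0..<int L}. {y. {x, y} \<in> E})"
      by (rule rev_image_eqI) (simp add: d)
  qed
  then have "finite ?D"
    by (rule finite_subset) (intro finite_imageI finite_SigmaI fin, simp)
  moreover have "nat \<bar>x - y\<bar> \<in> ?D" using \<open>{x, y} \<in> E\<close> by blast
  ultimately have "nat \<bar>x - y\<bar> \<le> interaction_range E"
    unfolding interaction_range_def by (rule Max_ge)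
  then show "\<bar>x - y\<bar> \<le> int (interaction_range E)" by simp
qed

lemma deg_in_shift:
  assumes per: "translation_period E L"
    and rng: "edges_within E K"
    and same: "\<And>d. \<bar>d\<bar> \<le> int K \<Longrightarrow> u + d \<in> A \<longleftrightarrow> u + t * int L + d \<in> B"
  shows "deg_in E B (u + t * int L) = deg_in E A u"
proof -
  let ?s = "\<lambda>v. v + t * int L"
  have "{v \<in> B. {u + t * int L, v} \<in> E} = ?s ` {v \<in> A. {u, v} \<in> E}"
  proof (intro set_eqI iffI)
    fix w assume w: "w \<in> {v \<in> B. {u + t * int L, v} \<in> E}"
    define v where "v = w - t * int L"
    have wv: "w = ?s v" by (simp add: v_def)
    with w have e: "{u, v} \<in> E" using period_shift[OF per, of u t v] by simp
    have "v \<in> A"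
      using same[of "v - u"] edges_withinD[OF rng e] w wv by (simp add: algebra_simps abs_minus_commute)
    with e wv show "w \<in> ?s ` {v \<in> A. {u, v} \<in> E}" by blast
  next
    fix w assume "w \<in> ?s ` {v \<in> A. {u, v} \<in> E}"
    then obtain v where v: "w = ?s v" "v \<in> A" "{u, v} \<in> E" by blast
    then show "w \<in> {v \<in> B. {u + t * int L, v} \<in> E}"
      using same[of "v - u"] edges_withinD[OF rng v(3)] period_shift[OF per, of u t v]
      by (simp add: algebra_simps abs_minus_commute)
  qed
  moreover have "inj_on ?s {v \<in> A. {u, v} \<in> E}" by (simp add: inj_on_def)
  ultimately show ?thesis unfolding deg_in_def by (simp add: card_image)
qed

text \<open>Being a majority set is a local property: if each vertex of \<open>S'\<close> sees, within distance \<open>K\<close>, a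
  copy of what a vertex of the majority set \<open>S\<close> in the same residue class sees, then the counts of
  neighbours agree. This is the common reason why translating and cutting are harmless.\<close>

lemma majority_setI_locally:
  assumes per: "translation_period E L"
    and rng: "edges_within E K"
    and S: "majority_set E S" and "finite S'" and "S' \<noteq> {}"
    and looks: "\<And>u. u \<in> S' \<Longrightarrow> \<exists>t. \<forall>d. \<bar>d\<bar> \<le> int K \<longrightarrow> u + d \<in> S' \<longleftrightarrow> u + t * int L + d \<in> S"
  shows "majority_set E S'"
  unfolding majority_set_def
proof (intro conjI ballI)
  fix u assume u: "u \<in> S'"
  then obtain t where t: "\<And>d. \<bar>d\<bar> \<le> int K \<Longrightarrow> u + d \<in> S' \<longleftrightarrow> u + t * int L + d \<in> S"
    using looks by blast
  have "u + t * int L \<in> S" using t[of 0] u by simp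
  then have "deg_in E (- S) (u + t * int L) < deg_in E S (u + t * int L)"
    using S by (simp add: majority_set_def)
  moreover have "deg_in E S (u + t * int L) = deg_in E S' u"
    by (rule deg_in_shift[OF per rng t])
  moreover have "deg_in E (- S) (u + t * int L) = deg_in E (- S') u"
    by (rule deg_in_shift[OF per rng]) (use t in auto)
  ultimately show "deg_in E (- S') u < deg_in E S' u" by simp
qed (use assms in auto)

lemma majority_set_translate:
  assumes "translation_period E L"
    and "edges_within E K"
    and S: "majority_set E S"
  shows "majority_set E ((\<lambda>v. v + t * int L) ` S)"
proof (rule majority_setI_locally[OF assms])
  fix u
  have "u + d \<in> (\<lambda>v. v + t * int L) ` S \<longleftrightarrow> u + (- t) * int L + d \<in> S" for d
    by (auto simp: algebra_simps image_iff intro!: bexI[of _ "u + d - t * int L"])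
  then show "\<exists>r. \<forall>d. \<bar>d\<bar> \<le> int K \<longrightarrow>
      u + d \<in> (\<lambda>v. v + t * int L) ` S \<longleftrightarrow> u + r * int L + d \<in> S"
    by blast
qed (use S in \<open>auto simp: majority_set_def\<close>)

text \<open>To the left of \<open>x + 2 * K\<close> the cut set agrees with \<open>S\<close>; from \<open>x\<close> on it agrees, thanks to the
  repeated window, with \<open>S\<close> moved left by \<open>t * L\<close>. The two regions overlap in \<open>2 * K\<close> places, so the
  neighbourhood of radius \<open>K\<close> of any vertex lies entirely in one of them; the case distinction is at
  the middle \<open>x + K\<close> of the overlap.\<close>

lemma majority_set_cut:
  assumes "translation_period E L"
    and "edges_within E K"
    and S: "majority_set E S"
    and window: "\<And>v. x \<le> v \<Longrightarrow> v < x + 2 * int K \<Longrightarrow> v \<in> S \<longleftrightarrow> v + t * int L \<in> S"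
    and s: "s \<in> S" "s < x + 2 * int K"
  defines "S' \<equiv> {v \<in> S. v < x + 2 * int K} \<union> {v. x + 2 * int K \<le> v \<and> v + t * int L \<in> S}"
  shows "majority_set E S'"
proof (rule majority_setI_locally[OF assms(1-3)])
  have "finite S" using S by (simp add: majority_set_def)
  moreover have "{v. x + 2 * int K \<le> v \<and> v + t * int L \<in> S} \<subseteq> (\<lambda>v. v - t * int L) ` S"
    by force
  ultimately show "finite S'"
    by (auto simp: S'_def intro: finite_subset)
  show "S' \<noteq> {}" using s by (auto simp: S'_def)
  fix u
  have right: "v \<in> S' \<longleftrightarrow> v + t * int L \<in> S" if "x \<le> v" for v
    using that window[of v] by (auto simp: S'_def not_le)
  show "\<exists>r. \<forall>d. \<bar>d\<bar> \<le> int K \<longrightarrow> u + d \<in> S' \<longleftrightarrow> u + r * int L + d \<in> S"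
  proof (cases "u < x + int K")
    case True
    then have "\<forall>d. \<bar>d\<bar> \<le> int K \<longrightarrow> u + d \<in> S' \<longleftrightarrow> u + 0 * int L + d \<in> S"
      by (auto simp: S'_def)
    then show ?thesis by blast
  next
    case False
    then have "\<forall>d. \<bar>d\<bar> \<le> int K \<longrightarrow> u + d \<in> S' \<longleftrightarrow> u + t * int L + d \<in> S"
      using right by (auto simp: algebra_simps)
    then show ?thesis by blast
  qed
qed

text \<open>The bound leaves room, to the right of \<open>K + L\<close>, for \<open>4 ^ K + 1\<close> windows of length \<open>2 * K\<close> starting
  \<open>L\<close> apart, one more than the number of possible window contents.\<close>

definition search_bound :: "nat \<Rightarrow> nat \<Rightarrow> nat" where
  "search_bound L K = 3 * K + 1 + (4 ^ K + 1) * L"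

lemma repeated_window:
  fixes S :: "int set" and x :: "nat \<Rightarrow> int"
  obtains i j where "i < j" and "j \<le> 4 ^ K"
    and "\<And>k. k < 2 * K \<Longrightarrow> x i + int k \<in> S \<longleftrightarrow> x j + int k \<in> S"
proof -
  let ?W = "\<lambda>j. {k. k < 2 * K \<and> x j + int k \<in> S}"
  have "?W ` {..4 ^ K} \<subseteq> Pow {..<2 * K}" by auto
  then have "card (?W ` {..4 ^ K}) \<le> card (Pow {..<2 * K})"
    by (intro card_mono) auto
  also have "\<dots> = 4 ^ K" by (simp add: card_Pow power_mult)
  also have "\<dots> < card {..4 ^ K :: nat}" by simp
  finally have "\<not> inj_on ?W {..4 ^ K}" by (rule pigeonhole)
  then obtain a b where "a \<le> 4 ^ K" "b \<le> 4 ^ K" "a \<noteq> b" "?W a = ?W b"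
    by (auto simp: inj_on_def)
  then show thesis
    using that[of a b] that[of b a] by (cases "a < b") auto
qed

text \<open>A majority set that reaches beyond the bound contains a repeated window, and cutting there lowers
  its maximum. All windows start to the right of \<open>K + L\<close>, hence the element \<open>s\<close> survives the cut: it
  keeps the set nonempty and keeps the hypothesis for the next round.\<close>

lemma majority_set_confine:
  assumes per: "translation_period E L"
    and rng: "edges_within E K"
    and S: "majority_set E S" and low: "S \<subseteq> {int K + 1..}"
    and s: "s \<in> S" "s \<le> int K + int L" and up: "\<forall>v\<in>S. v \<le> int n"
  shows "\<exists>S'. majority_set E S' \<and> S' \<subseteq> {int K + 1..int (search_bound L K)}"
  using S low s up
proof (induction n arbitrary: S)
  case 0
  then show ?case by force
next
  case (Suc n)
  show ?case
  proof (cases "Suc n \<le> search_bound L K")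
    case True
    with Suc.prems have "S \<subseteq> {int K + 1..int (search_bound L K)}" by force
    with Suc.prems(1) show ?thesis by blast
  next
    case False
    have L: "1 \<le> L" using per by (simp add: translation_period_def)
    define x where "x j = int K + 1 + (int j + 1) * int L" for j
    obtain i j where ij: "i < j" "j \<le> 4 ^ K"
      and W: "\<And>k. k < 2 * K \<Longrightarrow> x i + int k \<in> S \<longleftrightarrow> x j + int k \<in> S"
      using repeated_window[of K x S] by metis
    define t where "t = int j - int i"
    have xj: "x j = x i + t * int L" by (simp add: x_def t_def algebra_simps)
    have t: "1 \<le> t * int L"
      using ij(1) L mult_mono[of 1 t 1 "int L"] by (simp add: t_def)
    have "x i + 2 * int K \<le> int (search_bound L K)"
    proof -
      have "int i \<le> int (4 ^ K)" using ij by simp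
      then have "int i + 1 \<le> 4 ^ K + 1" by simp
      then have "(int i + 1) * int L \<le> (4 ^ K + 1) * int L" by (rule mult_right_mono) simp
      then show ?thesis by (simp add: x_def search_bound_def algebra_simps)
    qed
    then have xi: "x i + 2 * int K \<le> int n" using False by linarith
    have xi_eq: "x i = int K + 1 + int i * int L + int L"
      by (simp add: x_def algebra_simps)
    have "0 \<le> int i * int L" by simp
    with xi_eq have sx: "s < x i + 2 * int K" and xi_ge: "int K + 1 \<le> x i"
      using Suc.prems(4) by linarith+
    define S' where
      "S' = {v \<in> S. v < x i + 2 * int K} \<union> {v. x i + 2 * int K \<le> v \<and> v + t * int L \<in> S}"
    have "v \<in> S \<longleftrightarrow> v + t * int L \<in> S" if "x i \<le> v" "v < x i + 2 * int K" for v
    proof -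
      define k where "k = nat (v - x i)"
      have "v = x i + int k" "k < 2 * K" using that by (auto simp: k_def)
      with W[of k] xj show ?thesis by (simp add: ac_simps)
    qed
    then have "majority_set E S'"
      unfolding S'_def using majority_set_cut[OF per rng Suc.prems(1) _ Suc.prems(3) sx] by blast
    moreover have "S' \<subseteq> {int K + 1..}"
      using Suc.prems(2) xi_ge by (auto simp: S'_def)
    moreover have "s \<in> S'" using Suc.prems(3) sx by (simp add: S'_def)
    moreover have "\<forall>v\<in>S'. v \<le> int n"
      using Suc.prems(5) xi t by (force simp: S'_def)
    ultimately show ?thesis using Suc.IH Suc.prems(4) by blast
  qed
qed

text \<open>A translation by a multiple of \<open>L\<close> brings the minimum of any majority set into
  \<open>{K + 1..K + L}\<close>. Starting above \<open>K\<close> makes all neighbours of the set positive, so that the codes below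
  can do without negative numbers.\<close>

lemma shrink_property_iff_bounded:
  assumes per: "translation_period E L"
    and rng: "edges_within E K"
  shows "shrink_property UNIV E \<longleftrightarrow>
    (\<nexists>S. majority_set E S \<and> S \<subseteq> {int K + 1..int (search_bound L K)})"
proof -
  have "\<exists>S'. majority_set E S' \<and> S' \<subseteq> {int K + 1..int (search_bound L K)}"
    if S: "majority_set E S" for S
  proof -
    have L: "0 < int L" using per by (simp add: translation_period_def)
    have fin: "finite S" "S \<noteq> {}" using S by (auto simp: majority_set_def)
    define t where "t = - ((Min S - int K - 1) div int L)"
    let ?S = "(\<lambda>v. v + t * int L) ` S"
    have m: "Min S + t * int L = int K + 1 + (Min S - int K - 1) mod int L"
      by (simp add: t_def minus_div_mult_eq_mod[symmetric])
    have S': "majority_set E ?S" by (rule majority_set_translate[OF per rng S])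
    have low: "?S \<subseteq> {int K + 1..}"
    proof
      fix w assume "w \<in> ?S"
      then obtain v where "v \<in> S" "w = v + t * int L" by blast
      with fin have "Min S + t * int L \<le> w" by simp
      moreover have "0 \<le> (Min S - int K - 1) mod int L"
        by (rule pos_mod_sign[OF L])
      ultimately have "int K + 1 \<le> w" using m by linarith
      then show "w \<in> {int K + 1..}" by simp
    qed
    have mem: "Min S + t * int L \<in> ?S" using fin by simp
    have small: "Min S + t * int L \<le> int K + int L"
      using m pos_mod_bound[OF L, of "Min S - int K - 1"] by linarith
    have "\<forall>v\<in>?S. v \<le> int (nat (Max ?S))"
    proof
      fix v assume "v \<in> ?S"
      then have "v \<le> Max ?S" using fin by simp
      also have "\<dots> \<le> int (nat (Max ?S))" by simp
      finally show "v \<le> int (nat (Max ?S))" .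
    qed
    then show ?thesis by (rule majority_set_confine[OF per rng S' low mem small])
  qed
  then show ?thesis unfolding shrink_property_iff by blast
qed

section \<open>The criterion in terms of codes\<close>

text \<open>For natural numbers \<open>u\<close> and \<open>v\<close> to be adjacent, some translate of \<open>{u, v}\<close> by a multiple of \<open>L\<close>
  must be an edge meeting \<open>{1..L}\<close>. It suffices to try translates with both ends positive, namely the
  one that takes the smaller end into \<open>{1..L}\<close>. A natural number \<open>a\<close> has the integer code \<open>2 * a\<close>, so
  the edge \<open>{a, b}\<close> has the code \<open>2 ^ (2 * a) + 2 ^ (2 * b)\<close>.\<close>

definition adjacent_code :: "nat \<Rightarrow> nat \<Rightarrow> nat \<Rightarrow> nat \<Rightarrow> bool" where
  "adjacent_code L c u v \<longleftrightarrow> \<not> u = v \<and>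
     (\<exists>t<u. t * L < u \<and> t * L < v \<and> 2 ^ (2 * (u - t * L)) + 2 ^ (2 * (v - t * L)) \<in> set_decode c)"

text \<open>All elements of the set with code \<open>T\<close> are below \<open>T\<close>, so their neighbours are below \<open>T + K\<close> and the
  ranges of \<open>u\<close> and \<open>v\<close> lose nothing.\<close>

definition majority_code :: "nat \<Rightarrow> nat \<Rightarrow> nat \<Rightarrow> nat \<Rightarrow> bool" where
  "majority_code L K c T \<longleftrightarrow> 0 < T \<and>
     (\<forall>u<T. u \<in> set_decode T \<longrightarrow> K < u \<and>
        card {v. v < T + K \<and> \<not> v \<in> set_decode T \<and> adjacent_code L c u v}
        < card {v. v < T + K \<and> v \<in> set_decode T \<and> adjacent_code L c u v})"

lemma base_edges_subset:
  assumes "simple_graph UNIV E" and rng: "edges_within E K"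
  shows "base_edges E L \<subseteq> Pow {1 - int K..int L + int K}"
proof
  fix e assume "e \<in> base_edges E L"
  then have e: "e \<in> E" "e \<inter> {1..int L} \<noteq> {}" by (auto simp: base_edges_def)
  then have "card e = 2" using assms(1) by (simp add: simple_graph_def)
  then obtain x y where "e = {x, y}" by (auto simp: card_2_iff)
  with e edges_withinD[OF rng, of x y] show "e \<in> Pow {1 - int K..int L + int K}" by auto
qed

lemma edge_code_in_edges_encode_iff:
  assumes "finite F" and "\<And>e. e \<in> F \<Longrightarrow> finite e" and "a \<noteq> b"
  shows "2 ^ (2 * a) + 2 ^ (2 * b) \<in> set_decode (edges_encode F) \<longleftrightarrow> {int a, int b} \<in> F"
proof -
  have code: "int_encode (int n) = 2 * n" for n
    by (simp add: int_encode_def sum_encode_def)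
  have "2 ^ (2 * a) + 2 ^ (2 * b) = set_encode (int_encode ` {int a, int b})"
    using assms(3) by (simp add: code)
  moreover have "set_decode (edges_encode F) = (\<lambda>e. set_encode (int_encode ` e)) ` F"
    using assms(1) by (simp add: edges_encode_def)
  moreover have "set_encode (int_encode ` {int a, int b}) = set_encode (int_encode ` e) \<longleftrightarrow>
      {int a, int b} = e" if "e \<in> F" for e
    using assms(2)[OF that]
    by (subst set_encode_eq)
      (simp_all only: inj_image_eq_iff[OF inj_int_encode] finite_imageI finite.intros)
  ultimately show ?thesis by (auto simp only: image_iff)
qed

lemma adjacent_code_iff:
  assumes sim: "simple_graph UNIV E" and per: "translation_period E L"
    and rng: "edges_within E K" and "K < u"
  shows "adjacent_code L (edges_encode (base_edges E L)) u v \<longleftrightarrow> {int u, int v} \<in> E"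
proof -
  have sub: "base_edges E L \<subseteq> Pow {1 - int K..int L + int K}"
    by (rule base_edges_subset[OF sim rng])
  then have finF: "finite (base_edges E L)"
    by (rule finite_subset) simp
  have fine: "finite e" if "e \<in> base_edges E L" for e
    using sub that by (meson PowD finite_atLeastAtMost_int finite_subset subsetD)
  have shift: "{int (u - t * L), int (v - t * L)} \<in> E \<longleftrightarrow> {int u, int v} \<in> E"
    if "t * L < u" "t * L < v" for t
    using that period_shift[OF per, of "int u" "- int t" "int v"] by (simp add: of_nat_diff)
  show ?thesis
  proof
    assume "adjacent_code L (edges_encode (base_edges E L)) u v"
    then obtain t where t: "u \<noteq> v" "t * L < u" "t * L < v"
      "2 ^ (2 * (u - t * L)) + 2 ^ (2 * (v - t * L)) \<in> set_decode (edges_encode (base_edges E L))"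
      unfolding adjacent_code_def by blast
    then have "u - t * L \<noteq> v - t * L" by simp
    from edge_code_in_edges_encode_iff[OF finF fine this] t(4)
    have "{int (u - t * L), int (v - t * L)} \<in> base_edges E L" by simp
    with shift[OF t(2,3)] show "{int u, int v} \<in> E" by (simp add: base_edges_def)
  next
    assume e: "{int u, int v} \<in> E"
    have "card {int u, int v} = 2" using sim e by (simp add: simple_graph_def)
    then have uv: "u \<noteq> v" by auto
    have v: "0 < v" using edges_withinD[OF rng e] \<open>K < u\<close> by linarith
    define w where "w = min u v"
    define t where "t = (w - 1) div L"
    have w: "0 < w" "w \<le> u" "w \<le> v" using v \<open>K < u\<close> by (auto simp: w_def)
    have L: "0 < L" using per by (simp add: translation_period_def)
    have "t * L \<le> w - 1" by (simp add: t_def)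
    with w have tL: "t * L < w" by linarith
    have "w - 1 < t * L + L"
      using div_mult_mod_eq[of "w - 1" L] mod_less_divisor[OF L, of "w - 1"] unfolding t_def
      by linarith
    with tL have "1 \<le> w - t * L" "w - t * L \<le> L" by linarith+
    moreover have "int r \<in> {1..int L}" if "1 \<le> r" "r \<le> L" for r
      using that by simp
    ultimately have wL: "int (w - t * L) \<in> {1..int L}" by blast
    have "t \<le> w - 1" by (simp add: t_def)
    with w have "t < u" by linarith
    have tu: "t * L < u" and tv: "t * L < v" using tL w by linarith+
    have "int (w - t * L) \<in> {int (u - t * L), int (v - t * L)}" by (auto simp: w_def min_def)
    with wL shift[OF tu tv] e have "{int (u - t * L), int (v - t * L)} \<in> base_edges E L"
      unfolding base_edges_def by blast
    moreover have "u - t * L \<noteq> v - t * L" using uv tu tv by linarith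
    ultimately have "2 ^ (2 * (u - t * L)) + 2 ^ (2 * (v - t * L)) \<in>
        set_decode (edges_encode (base_edges E L))"
      using edge_code_in_edges_encode_iff[OF finF fine] by blast
    with uv \<open>t < u\<close> tu tv show "adjacent_code L (edges_encode (base_edges E L)) u v"
      unfolding adjacent_code_def by blast
  qed
qed

lemma less_of_mem_set_decode:
  assumes "u \<in> set_decode T"
  shows "u < T"
proof -
  have "set_decode (2 ^ u) = {u}" using set_encode_inverse[of "{u}"] by simp
  then have "2 ^ u \<le> T" using assms by (intro subset_decode_imp_le) simp
  then show ?thesis using less_exp[of u] by linarith
qed

lemma deg_in_eq_card_code:
  assumes sim: "simple_graph UNIV E" and per: "translation_period E L"
    and rng: "edges_within E K" and u: "K < u" "u < T"
  shows "deg_in E A (int u) =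
    card {v. v < T + K \<and> int v \<in> A \<and> adjacent_code L (edges_encode (base_edges E L)) u v}"
    (is "_ = card ?C")
proof -
  have "{w \<in> A. {int u, w} \<in> E} = int ` ?C"
  proof (intro set_eqI iffI)
    fix w assume w: "w \<in> {w \<in> A. {int u, w} \<in> E}"
    then have "\<bar>int u - w\<bar> \<le> int K" using edges_withinD[OF rng] by blast
    then have "w = int (nat w)" "nat w < T + K" using u by linarith+
    with w adjacent_code_iff[OF sim per rng u(1), of "nat w"] show "w \<in> int ` ?C" by force
  next
    fix w assume "w \<in> int ` ?C"
    then show "w \<in> {w \<in> A. {int u, w} \<in> E}"
      using adjacent_code_iff[OF sim per rng u(1)] by blast
  qed
  then show ?thesis unfolding deg_in_def by (simp add: card_image)
qed

lemma majority_code_iff: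
  assumes sim: "simple_graph UNIV E" and per: "translation_period E L"
    and rng: "edges_within E K"
  shows "majority_code L K (edges_encode (base_edges E L)) T \<longleftrightarrow>
    majority_set E (int ` set_decode T) \<and> int ` set_decode T \<subseteq> {int K + 1..}"
proof -
  let ?S = "int ` set_decode T" and ?c = "edges_encode (base_edges E L)"
  have deg: "deg_in E ?S (int u) = card {v. v < T + K \<and> v \<in> set_decode T \<and> adjacent_code L ?c u v}"
    "deg_in E (- ?S) (int u) = card {v. v < T + K \<and> \<not> v \<in> set_decode T \<and> adjacent_code L ?c u v}"
    if "u \<in> set_decode T" "K < u" for u
    using deg_in_eq_card_code[OF sim per rng that(2) less_of_mem_set_decode[OF that(1)]]
    by (simp_all add: inj_image_mem_iff[OF inj_of_nat])
  have bounded: "(\<forall>u<T. u \<in> set_decode T \<longrightarrow> P u) \<longleftrightarrow> (\<forall>u\<in>set_decode T. P u)" for P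
    using less_of_mem_set_decode by blast
  have "set_decode T = {} \<longleftrightarrow> T = 0"
    by (metis set_decode_inverse set_decode_zero set_encode_empty)
  then have "0 < T \<longleftrightarrow> ?S \<noteq> {}" by auto
  moreover have "majority_code L K ?c T \<longleftrightarrow> 0 < T \<and>
      (\<forall>u\<in>set_decode T. K < u \<and> deg_in E (- ?S) (int u) < deg_in E ?S (int u))"
    unfolding majority_code_def bounded by (simp add: deg cong: conj_cong)
  moreover have "?S \<subseteq> {int K + 1..} \<longleftrightarrow> (\<forall>u\<in>set_decode T. K < u)" by auto
  ultimately show ?thesis
    unfolding majority_set_def by auto
qed

lemma set_encode_less:
  assumes "A \<subseteq> {..N}"
  shows "set_encode A < 2 ^ (N + 1)"
proof -
  have "set_encode A \<le> set_encode {..N}"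
    unfolding set_encode_def using assms by (intro sum_mono2) auto
  also have "\<dots> < 2 ^ (N + 1)"
    unfolding set_encode_def by (induction N) simp_all
  finally show ?thesis .
qed

definition has_majority_code :: "nat \<Rightarrow> nat \<Rightarrow> nat \<Rightarrow> bool" where
  "has_majority_code L K c \<longleftrightarrow> (\<exists>T<2 ^ (search_bound L K + 1). majority_code L K c T)"

lemma shrink_property_iff_code:
  assumes sim: "simple_graph UNIV E" and per: "translation_period E L"
    and rng: "edges_within E K"
  shows "shrink_property UNIV E \<longleftrightarrow> \<not> has_majority_code L K (edges_encode (base_edges E L))"
proof -
  let ?c = "edges_encode (base_edges E L)"
  have "has_majority_code L K ?c" if "majority_set E S" "S \<subseteq> {int K + 1..int (search_bound L K)}" for S
  proof -
    let ?T = "set_encode (nat ` S)"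
    have "finite S" using that(1) by (simp add: majority_set_def)
    then have dec: "set_decode ?T = nat ` S" by simp
    have "int ` nat ` S = (\<lambda>v. v) ` S"
      unfolding image_image using that(2) by (intro image_cong) auto
    then have S: "int ` set_decode ?T = S" by (simp add: dec)
    have "majority_code L K ?c ?T"
      using that unfolding majority_code_iff[OF sim per rng] S by auto
    moreover have "?T < 2 ^ (search_bound L K + 1)"
      by (rule set_encode_less) (use that(2) in \<open>auto simp: nat_le_iff dest!: subsetD\<close>)
    ultimately show ?thesis unfolding has_majority_code_def by blast
  qed
  moreover have "\<exists>S. majority_set E S" if "has_majority_code L K ?c"
    using that unfolding has_majority_code_def majority_code_iff[OF sim per rng] by blast
  ultimately show ?thesis
    using shrink_property_iff[of E] shrink_property_iff_bounded[OF per rng] by blast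
qed

section \<open>The decision procedure\<close>

lemma decidable_adjacent_code:
  assumes "computable X l" and "computable X c" and "computable X f" and "computable X g"
  shows "decidable X (\<lambda>x. adjacent_code (l x) (c x) (f x) (g x))"
  unfolding adjacent_code_def by (intro computable_intros assms)

lemma decidable_majority_code:
  assumes "computable X l" and "computable X k" and "computable X c" and "computable X t"
  shows "decidable X (\<lambda>x. majority_code (l x) (k x) (c x) (t x))"
  unfolding majority_code_def by (intro computable_intros decidable_adjacent_code assms)

lemma decidable_has_majority_code:
  assumes "computable X l" and "computable X k" and "computable X c"
  shows "decidable X (\<lambda>x. has_majority_code (l x) (k x) (c x))"
  unfolding has_majority_code_def search_bound_def
  by (intro computable_intros decidable_majority_code assms)

lemma ex_program_of_decidable:
  assumes "decidable [\<lambda>s. s 0, \<lambda>s. s 1, \<lambda>s. s 2] P"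
  obtains p where "\<And>s. \<exists>n s'. exec p s n s' \<and> s' 0 = (if P s then 1 else 0)"
proof -
  have "\<forall>l\<in>set [0, 1, 2]. l < (3 :: nat)" by simp
  with assms obtain p where
    p: "evaluates [\<lambda>s. s 0, \<lambda>s. s 1, \<lambda>s. s 2] (\<lambda>s. of_bool (P s)) [0, 1, 2] 3 p"
    by (rule computableE)
  have "\<exists>n s'. exec (Seq p (Assign 0 (Reg 3))) s n s' \<and> s' 0 = (if P s then 1 else 0)" for s
  proof -
    have "map s [0, 1, 2] = map (\<lambda>v. v s) [\<lambda>s. s 0, \<lambda>s. s 1, \<lambda>s. s 2]" by simp
    with p obtain n s' where "exec p s n s'" and s': "s' 3 = of_bool (P s)"
      by (rule evaluatesE)
    then have "exec (Seq p (Assign 0 (Reg 3))) s (n + 1) (s'(0 := rhs_val (Reg 3) s'))"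
      using exec.Seq exec.Assign by blast
    with s' show ?thesis by fastforce
  qed
  then show thesis by (rule that)
qed

theorem mainTheorem3:
  "\<exists>(p :: prog) (B :: nat \<Rightarrow> nat \<Rightarrow> nat).
     \<forall>E \<in> periodic_graphs. \<forall>L. translation_period E L \<longrightarrow>
       (\<exists>n s. exec p (graph_input E L) n s \<and>
              n \<le> B L (interaction_range E) \<and>
              s 0 = (if shrink_property UNIV E then 1 else 0))"
proof -
  let ?P = "\<lambda>s. \<not> has_majority_code (s 0) (s 1) (s 2)"
  have "decidable [\<lambda>s. s 0, \<lambda>s. s 1, \<lambda>s. s 2] ?P"
    by (intro decidable_not decidable_has_majority_code computable_var) simp_all
  then obtain p where "\<And>s. \<exists>n s'. exec p s n s' \<and> s' 0 = (if ?P s then 1 else 0)"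
    by (rule ex_program_of_decidable) blast
  then obtain steps out where
    p: "\<And>s. exec p s (steps s) (out s)" "\<And>s. out s 0 = (if ?P s then 1 else 0)"
    by metis
  \<comment> \<open>The edges meeting \<open>{1..L}\<close> lie within \<open>{1 - K..L + K}\<close>, so only finitely many inputs share
    the same \<open>L\<close> and \<open>K\<close>, and the sum of their running times is a bound.\<close>
  define codes where
    "codes L K = edges_encode ` Pow (Pow {1 - int K..int L + int K})" for L K
  define B where "B L K = (\<Sum>c\<in>codes L K. steps (input_state [L, K, c]))" for L K
  have "exec p (graph_input E L) (steps (graph_input E L)) (out (graph_input E L)) \<and>
      steps (graph_input E L) \<le> B L (interaction_range E) \<and>
      out (graph_input E L) 0 = (if shrink_property UNIV E then 1 else 0)"
    if "E \<in> periodic_graphs" and per: "translation_period E L" for E L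
  proof -
    let ?K = "interaction_range E" and ?c = "edges_encode (base_edges E L)"
    have sim: "simple_graph UNIV E" and "bounded_degree UNIV E"
      using that(1) by (auto simp: periodic_graphs_def)
    then have rng: "edges_within E ?K"
      using per by (intro edges_within_interaction_range)
    have "base_edges E L \<in> Pow (Pow {1 - int ?K..int L + int ?K})"
      using base_edges_subset[OF sim rng] by blast
    then have "?c \<in> codes L ?K"
      unfolding codes_def by (rule imageI)
    moreover have "finite (codes L ?K)" by (simp add: codes_def)
    ultimately have "steps (input_state [L, ?K, ?c]) \<le> B L ?K"
      unfolding B_def by (intro member_le_sum) simp_all
    moreover have "?P (graph_input E L) \<longleftrightarrow> shrink_property UNIV E"
      using shrink_property_iff_code[OF sim per rng]
      by (simp add: graph_input_def input_state_def numeral_2_eq_2)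
    ultimately show ?thesis
      using p by (simp add: graph_input_def)
  qed
  then show ?thesis by blast
qed

end
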